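(* There exists a Hausdorff topological space $X$ which is weakly Lindelöf but not quasi-Lindelöf (and not even Lindelöf).
   Context: A topological space $X$ is called weakly Lindelöf if for every open cover $\mathcal{U}$ of $X$ there is a countable subfamily $\mathcal{U}'\subseteq\mathcal{U}$ such that $X=\overline{\bigcup\mathcal{U}'}$. A topological space $X$ is called quasi-Lindelöf if for every closed subset $C\subseteq X$ and every family $\mathcal{U}$ of open subsets of $X$ with $C\subseteq\bigcup\mathcal{U}$ there is a countable subfamily $\mathcal{U}'\subseteq\mathcal{U}$ such that $C\subseteq\overline{\bigcup\mathcal{U}'}$. Closures are taken in $X$. All spaces are assumed Hausdorff. *)

theory Defs
  imports "HOL-Analysis.Analysis"
begin

definition weakly_Lindelof_space :: "'a topology \<Rightarrow> bool" where
  "weakly_Lindelof_space X \<longleftrightarrow>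
    (\<forall>\<U>. (\<forall>U \<in> \<U>. openin X U) \<and> \<Union>\<U> = topspace X
        \<longrightarrow> (\<exists>\<V>. countable \<V> \<and> \<V> \<subseteq> \<U> \<and> X closure_of \<Union>\<V> = topspace X))"

definition quasi_Lindelof_space :: "'a topology \<Rightarrow> bool" where
  "quasi_Lindelof_space X \<longleftrightarrow>
    (\<forall>C \<U>. closedin X C \<and> (\<forall>U \<in> \<U>. openin X U) \<and> C \<subseteq> \<Union>\<U>
        \<longrightarrow> (\<exists>\<V>. countable \<V> \<and> \<V> \<subseteq> \<U> \<and> C \<subseteq> X closure_of \<Union>\<V>))"

end

theory Submission imports Defs begin

text \<open>
  The space is the punctured plank \<open>(A \<times> (\<omega> + 1)) - {(\<infinity>, \<omega>)}\<close>, where \<open>A\<close> is the one-point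
  compactification of an uncountable discrete set. The product is compact Hausdorff, so the
  plank is Hausdorff. The levels \<open>A \<times> {n}\<close> with \<open>n < \<omega>\<close> are compact, so an open cover has a
  countable subfamily that covers all of them; since they form a dense set, the
  space is weakly Lindelof. The removal of the corner \<open>(\<infinity>, \<omega>)\<close> makes the remaining points of
  the top level \<open>\<omega>\<close> an uncountable closed discrete set. The columns \<open>{d} \<times> (\<omega> + 1)\<close> are
  pairwise disjoint open sets, each of which contains exactly one point of the top level. A union
  of countably many columns is disjoint from some other column, so its closure
  misses a point of the top level. Hence the space is not quasi-Lindelof, and therefore not Lindelof.

  To have a topology on real numbers, the plank is coded on the positive reals. The
  fractional part of \<open>x\<close> is the coordinate in \<open>A = {0<..<1} \<union> {\<infinity>}\<close>, with \<open>0\<close> in the role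
  of \<open>\<infinity>\<close>; the integer part of \<open>x\<close> is the level, with \<open>0\<close> in the role of \<open>\<omega>\<close>. The
  removed corner is then the number \<open>0\<close>.
\<close>

section \<open>The topology of the punctured plank\<close>

text \<open>
  The two finiteness conditions are the neighbourhood filters of the plank at its non-isolated points:
  a neighbourhood of \<open>(\<infinity>, n)\<close> omits only finitely many points of its level, and one
  of \<open>(d, \<omega>)\<close> omits only finitely many points of its column.
\<close>
definition plank_open :: "real set \<Rightarrow> bool" where
  "plank_open U \<longleftrightarrow> U \<subseteq> {0<..}
     \<and> (\<forall>n::nat. real n \<in> U \<longrightarrow> finite {d \<in> {0<..<1}. d + real n \<notin> U})
     \<and> (\<forall>d \<in> {0<..<1}. d \<in> U \<longrightarrow> finite {n::nat. d + real n \<notin> U})"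

definition plank :: "real topology" where
  "plank = topology plank_open"

lemma istopology_plank_open: "istopology plank_open"
  unfolding istopology_def
proof (intro conjI allI impI)
  fix S T assume S: "plank_open S" and T: "plank_open T"
  show "plank_open (S \<inter> T)"
    unfolding plank_open_def
  proof (intro conjI allI ballI impI)
    show "S \<inter> T \<subseteq> {0<..}" using S by (auto simp: plank_open_def)
  next
    fix n :: nat assume "real n \<in> S \<inter> T"
    then have "finite ({d \<in> {0<..<1}. d + real n \<notin> S} \<union> {d \<in> {0<..<1}. d + real n \<notin> T})"
      using S T by (simp add: plank_open_def)
    then show "finite {d \<in> {0<..<1}. d + real n \<notin> S \<inter> T}"
      by (rule rev_finite_subset) auto
  next
    fix d :: real assume "d \<in> {0<..<1}" "d \<in> S \<inter> T"
    then have "finite ({n::nat. d + real n \<notin> S} \<union> {n. d + real n \<notin> T})"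
      using S T by (simp add: plank_open_def)
    then show "finite {n::nat. d + real n \<notin> S \<inter> T}"
      by (rule rev_finite_subset) auto
  qed
next
  fix \<K> assume K: "\<forall>K\<in>\<K>. plank_open K"
  show "plank_open (\<Union>\<K>)"
    unfolding plank_open_def
  proof (intro conjI allI ballI impI)
    show "\<Union>\<K> \<subseteq> {0<..}" using K by (auto simp: plank_open_def)
  next
    fix n :: nat assume "real n \<in> \<Union>\<K>"
    then obtain K where "K \<in> \<K>" "real n \<in> K" by blast
    then have "finite {d \<in> {0<..<1}. d + real n \<notin> K}"
      using K by (simp add: plank_open_def)
    then show "finite {d \<in> {0<..<1}. d + real n \<notin> \<Union>\<K>}"
      by (rule rev_finite_subset) (use \<open>K \<in> \<K>\<close> in auto)
  next
    fix d :: real assume d: "d \<in> {0<..<1}" "d \<in> \<Union>\<K>"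
    then obtain K where "K \<in> \<K>" "d \<in> K" by blast
    then have "finite {n::nat. d + real n \<notin> K}"
      using K d by (simp add: plank_open_def)
    then show "finite {n::nat. d + real n \<notin> \<Union>\<K>}"
      by (rule rev_finite_subset) (use \<open>K \<in> \<K>\<close> in auto)
  qed
qed

lemma openin_plank: "openin plank U \<longleftrightarrow> plank_open U"
  unfolding plank_def by (simp add: istopology_plank_open topology_inverse')

lemma topspace_plank: "topspace plank = {0<..}"
proof -
  have "openin plank {0<..}"
    by (auto simp: openin_plank plank_open_def add_pos_nonneg not_less intro: finite_subset[OF _ finite.emptyI])
  then show ?thesis
    using openin_subset[of plank "{0<..}"] openin_topspace[of plank]
    unfolding openin_plank plank_open_def by blast
qed

section \<open>Clopen columns and levels\<close>

definition column :: "real \<Rightarrow> real set" where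
  "column d = {x. 0 < x \<and> frac x = d}"

definition level :: "nat \<Rightarrow> real set" where
  "level n = {real n..<real n + 1}"

lemma frac_add_nat: "d \<in> {0<..<1} \<Longrightarrow> frac (d + real n) = d"
  by (simp add: frac_unique_iff)

lemma openin_column:
  assumes "d \<in> {0<..<1}"
  shows "openin plank (column d)"
proof -
  have "{n::nat. d + real n \<notin> column d} = {}"
    using assms by (auto simp: column_def frac_add_nat add_pos_nonneg)
  moreover have "e = d" if "e \<in> {0<..<1}" "e \<in> column d" for e
    using that frac_add_nat[of e 0] by (simp add: column_def)
  ultimately show ?thesis
    using assms unfolding openin_plank plank_open_def
    by (auto simp: column_def)
qed

lemma openin_compl_column:
  assumes "d \<in> {0<..<1}"
  shows "openin plank ({0<..} - column d)"
  unfolding openin_plank plank_open_def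
proof (intro conjI allI ballI impI)
  fix n :: nat
  have "{e \<in> {0<..<1}. e + real n \<notin> {0<..} - column d} \<subseteq> {d}"
    by (auto simp: column_def frac_add_nat)
  then show "finite {e \<in> {0<..<1}. e + real n \<notin> {0<..} - column d}"
    by (rule finite_subset) simp
next
  fix e :: real assume e: "e \<in> {0<..<1}" "e \<in> {0<..} - column d"
  then have "e \<noteq> d"
    using frac_add_nat[of e 0] by (auto simp: column_def)
  then have "{n::nat. e + real n \<notin> {0<..} - column d} = {}"
    using e by (auto simp: column_def frac_add_nat)
  then show "finite {n::nat. e + real n \<notin> {0<..} - column d}"
    by simp
qed auto

lemma openin_level:
  assumes "n \<ge> 1"
  shows "openin plank (level n)"
  unfolding openin_plank plank_open_def
proof (intro conjI allI ballI impI)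
  show "level n \<subseteq> {0<..}" using assms by (auto simp: level_def)
next
  fix m :: nat assume "real m \<in> level n"
  then have "m = n" by (simp add: level_def)
  then have "{d \<in> {0<..<1}. d + real m \<notin> level n} = {}"
    by (auto simp: level_def)
  then show "finite {d \<in> {0<..<1}. d + real m \<notin> level n}"
    by (simp only: finite.emptyI)
next
  fix d :: real assume "d \<in> {0<..<1}" "d \<in> level n"
  then show "finite {m::nat. d + real m \<notin> level n}"
    using assms by (auto simp: level_def)
qed

lemma openin_compl_level:
  "openin plank ({0<..} - level n)"
  unfolding openin_plank plank_open_def
proof (intro conjI allI ballI impI)
  fix m :: nat assume "real m \<in> {0<..} - level n"
  then have "m \<noteq> n" by (auto simp: level_def)
  then have "{d \<in> {0<..<1}. d + real m \<notin> {0<..} - level n} = {}"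
    by (auto simp: level_def)
  then show "finite {d \<in> {0<..<1}. d + real m \<notin> {0<..} - level n}"
    by (simp only: finite.emptyI)
next
  fix d :: real assume d: "d \<in> {0<..<1}"
  then have "{m::nat. d + real m \<notin> {0<..} - level n} \<subseteq> {n}"
    by (auto simp: level_def)
  then show "finite {m::nat. d + real m \<notin> {0<..} - level n}"
    by (rule finite_subset) simp
qed auto

section \<open>Hausdorff separation\<close>

text \<open>
  Two distinct points differ in a coordinate. At most one of the two values there is the
  limit value (\<open>\<infinity>\<close> or \<open>\<omega>\<close>), and the other value gives a clopen column or level
  that separates the points.
\<close>
lemma Hausdorff_plank: "Hausdorff_space plank"
proof -
  have sep: "\<exists>U V. openin plank U \<and> openin plank V \<and> x \<in> U \<and> y \<in> V \<and> disjnt U V"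
    if "x > 0" "y > 0" "x \<noteq> y"
      and less: "frac y < frac x \<or> frac x = frac y \<and> floor y < floor x" for x y
    using less
  proof
    assume lt: "frac y < frac x"
    then have "frac x \<in> {0<..<1}"
      using le_less_trans[OF frac_ge_0[of y] lt] frac_lt_1[of x]
      unfolding greaterThanLessThan_iff by blast
    then have "openin plank (column (frac x))" "openin plank ({0<..} - column (frac x))"
      by (rule openin_column openin_compl_column)+
    moreover have "x \<in> column (frac x)" "y \<in> {0<..} - column (frac x)"
      using that lt by (auto simp: column_def)
    ultimately show ?thesis by (meson Diff_disjoint disjnt_def)
  next
    assume lt: "frac x = frac y \<and> floor y < floor x"
    define n where "n = nat (floor x)"
    have "0 \<le> floor y" using that by simp
    then have "1 \<le> floor x" using lt by linarith
    then have floors: "1 \<le> floor x" "real n = of_int (floor x)"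
      by (simp_all add: n_def)
    then have "n \<ge> 1" by linarith
    then have "openin plank (level n)" "openin plank ({0<..} - level n)"
      by (rule openin_level, intro openin_compl_level)
    moreover have "x \<in> level n"
      unfolding level_def floors(2) using floor_correct[of x] by auto
    moreover have "y \<in> {0<..} - level n"
      unfolding level_def floors(2) using that lt by (auto simp: le_floor_iff[symmetric])
    ultimately show ?thesis by (meson Diff_disjoint disjnt_def)
  qed
  show ?thesis
    unfolding Hausdorff_space_def topspace_plank
  proof (intro allI impI, elim conjE)
    fix x y :: real assume xy: "x \<in> {0<..}" "y \<in> {0<..}" "x \<noteq> y"
    have "\<not> (frac x = frac y \<and> floor x = floor y)"
      using xy by (metis frac_def diff_add_cancel)
    then consider "frac y < frac x \<or> frac x = frac y \<and> floor y < floor x"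
      | "frac x < frac y \<or> frac y = frac x \<and> floor x < floor y"
      by linarith
    then show "\<exists>U V. openin plank U \<and> openin plank V \<and> x \<in> U \<and> y \<in> V \<and> disjnt U V"
    proof cases
      case 1
      then show ?thesis using sep[of x y] xy by auto
    next
      case 2
      then show ?thesis using sep[of y x] xy by (metis disjnt_sym greaterThan_iff)
    qed
  qed
qed

section \<open>Covering properties\<close>

lemma closure_of_lower_levels: "plank closure_of {1..} = {0<..}"
proof
  show "plank closure_of {1..} \<subseteq> {0<..}"
    using closure_of_subset_topspace[of plank] by (simp add: topspace_plank)
  show "{0<..} \<subseteq> plank closure_of {1..}"
  proof
    fix x :: real assume x: "x \<in> {0<..}"
    have "\<exists>y \<in> {1..}. y \<in> U" if U: "openin plank U" "x \<in> U" for U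
    proof (cases "x < 1")
      case True
      then have "finite {n::nat. x + real n \<notin> U}"
        using U x by (auto simp: openin_plank plank_open_def)
      then have "finite (insert 0 {n::nat. x + real n \<notin> U})"
        by simp
      then obtain n where "n \<notin> insert 0 {n::nat. x + real n \<notin> U}"
        using ex_new_if_finite infinite_UNIV_nat by blast
      then show ?thesis
        using x by (intro bexI[of _ "x + real n"]) auto
    next
      case False
      then show ?thesis using U by auto
    qed
    then show "x \<in> plank closure_of {1..}"
      using x by (auto simp: in_closure_of topspace_plank)
  qed
qed

text \<open>
  Members of the cover that contain the limit points \<open>(\<infinity>, n)\<close> leave only finitely many points on
  each level below \<open>\<omega>\<close>, hence countably many points in total.
\<close>
lemma weakly_Lindelof_plank: "weakly_Lindelof_space plank"
  unfolding weakly_Lindelof_space_def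
proof (intro allI impI, elim conjE)
  fix \<U> assume opn: "\<forall>U\<in>\<U>. openin plank U" and cov: "\<Union>\<U> = topspace plank"
  have "\<forall>x \<in> {0<..}. \<exists>U. U \<in> \<U> \<and> x \<in> U"
    using cov by (auto simp: topspace_plank)
  then obtain P where P: "\<And>x. x > 0 \<Longrightarrow> P x \<in> \<U> \<and> x \<in> P x"
    by (auto dest!: bchoice)
  define E where
    "E = (\<Union>n\<in>{1::nat..}. insert (real n) ((\<lambda>d. d + real n) ` {d \<in> {0<..<1}. d + real n \<notin> P (real n)}))"
  have "finite {d \<in> {0<..<1}. d + real n \<notin> P (real n)}" if "n \<ge> 1" for n :: nat
    using P[of "real n"] opn that by (auto simp: openin_plank plank_open_def)
  then have "countable E"
    unfolding E_def by (intro countable_UN) (auto intro: countable_finite)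
  have Epos: "x > 0" if "x \<in> E" for x
    using that by (auto simp: E_def add_pos_nonneg)
  have "{1..} \<subseteq> \<Union>(P ` E)"
  proof
    fix x :: real assume x: "x \<in> {1..}"
    define n where "n = nat (floor x)"
    have n: "n \<ge> 1" "real n = of_int (floor x)"
      using x by (auto simp: n_def le_nat_iff)
    have xn: "x = frac x + real n"
      by (simp add: frac_def n)
    show "x \<in> \<Union>(P ` E)"
    proof (cases "x \<in> P (real n)")
      case True
      moreover have "real n \<in> E" using \<open>n \<ge> 1\<close> unfolding E_def by blast
      ultimately show ?thesis by blast
    next
      case False
      then have "x \<noteq> real n"
        using P[of "real n"] \<open>n \<ge> 1\<close> by auto
      then have "frac x \<noteq> 0"
        using xn by linarith
      then have "frac x \<in> {0<..<1}"
        using frac_ge_0[of x] frac_lt_1[of x]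
        unfolding greaterThanLessThan_iff by linarith
      then have "x \<in> (\<lambda>d. d + real n) ` {d \<in> {0<..<1}. d + real n \<notin> P (real n)}"
        using xn False by (intro image_eqI[of _ _ "frac x"]) auto
      then have "x \<in> E"
        using \<open>n \<ge> 1\<close> unfolding E_def by blast
      then show ?thesis using P[of x] x by auto
    qed
  qed
  then have "plank closure_of {1..} \<subseteq> plank closure_of \<Union>(P ` E)"
    by (rule closure_of_mono)
  then have "plank closure_of \<Union>(P ` E) = topspace plank"
    using closure_of_subset_topspace[of plank "\<Union>(P ` E)"]
    by (simp add: closure_of_lower_levels topspace_plank)
  moreover have "P ` E \<subseteq> \<U>" using P Epos by auto
  ultimately show "\<exists>\<V>. countable \<V> \<and> \<V> \<subseteq> \<U> \<and> plank closure_of \<Union>\<V> = topspace plank"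
    using \<open>countable E\<close> by blast
qed

lemma not_quasi_Lindelof_plank: "\<not> quasi_Lindelof_space plank"
proof
  assume quasi: "quasi_Lindelof_space plank"
  define C :: "real set" where "C = {0<..<1}"
  have frac_C: "frac d = d" if "d \<in> C" for d
    using frac_add_nat[of d 0] that by (simp add: C_def)
  have "openin plank (\<Union>n\<in>{1..}. level n)"
    by (intro openin_Union) (auto intro: openin_level)
  moreover have "(\<Union>n\<in>{1..}. level n) = {0<..} - C"
  proof (intro equalityI subsetI)
    fix x assume "x \<in> {0<..} - C"
    then have "x \<ge> 1" by (auto simp: C_def)
    then have "nat (floor x) \<ge> 1" "x \<in> level (nat (floor x))"
      by (auto simp: level_def le_nat_iff)
    then show "x \<in> (\<Union>n\<in>{1..}. level n)" by blast
  qed (auto simp: level_def C_def)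
  ultimately have "closedin plank C"
    by (auto simp: closedin_def topspace_plank C_def)
  moreover have "\<forall>U \<in> column ` C. openin plank U"
    by (auto simp: C_def intro!: openin_column)
  moreover have "C \<subseteq> \<Union>(column ` C)"
    using frac_C by (force simp: column_def C_def)
  ultimately obtain \<V> where \<V>: "countable \<V>" "\<V> \<subseteq> column ` C" "C \<subseteq> plank closure_of \<Union>\<V>"
    using quasi unfolding quasi_Lindelof_space_def by metis
  then obtain E where E: "countable E" "E \<subseteq> C" "\<V> = column ` E"
    by (metis countable_subset_image)
  have "uncountable C"
    by (simp add: C_def uncountable_open_interval)
  then obtain d where d: "d \<in> C" "d \<notin> E"
    using E by (metis countable_subset subsetI)
  have "openin plank (column d)" "d \<in> column d"
    using d frac_C[of d] openin_column[of d] by (simp_all add: C_def column_def)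
  moreover have "d \<in> plank closure_of \<Union>\<V>"
    using \<V> d by blast
  ultimately have "\<exists>y \<in> \<Union>\<V>. y \<in> column d"
    by (auto simp: in_closure_of)
  then show False
    using d E by (auto simp: column_def)
qed

lemma Lindelof_imp_quasi_Lindelof:
  assumes "Lindelof_space X"
  shows "quasi_Lindelof_space X"
  unfolding quasi_Lindelof_space_def
proof (intro allI impI, elim conjE)
  fix C \<U> assume C: "closedin X C" and opn: "\<forall>U\<in>\<U>. openin X U" and cov: "C \<subseteq> \<Union>\<U>"
  have "Lindelof_space (subtopology X C)"
    using assms C by (rule Lindelof_space_closedin_subtopology)
  then obtain \<V> where \<V>: "countable \<V>" "\<V> \<subseteq> \<U>" "C \<subseteq> \<Union>\<V>"
    using Lindelof_space_subtopology_subset[OF closedin_subset[OF C]] opn cov by meson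
  moreover have "\<Union>\<V> \<subseteq> X closure_of \<Union>\<V>"
    by (intro closure_of_subset) (use \<V> opn openin_subset in blast)
  ultimately show "\<exists>\<V>. countable \<V> \<and> \<V> \<subseteq> \<U> \<and> C \<subseteq> X closure_of \<Union>\<V>"
    by blast
qed

theorem mainTheorem1:
  "\<exists>X :: real topology.
     Hausdorff_space X \<and> weakly_Lindelof_space X \<and>
     \<not> quasi_Lindelof_space X \<and> \<not> Lindelof_space X"
  using Hausdorff_plank weakly_Lindelof_plank not_quasi_Lindelof_plank
    Lindelof_imp_quasi_Lindelof by blast

end
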